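(* Let $f:\{0,1\}^n\rightarrow\{0,1\}$ and let $\delta\in(0,1/2]$. Suppose $f$ has a $(\frac{1}{2}-\delta)$-error probabilistic polynomial $\mathbf{P}$ of degree $D$ with $\Vert\mathbf{P}\Vert_\infty\leq L$, where $L\geq 2$. Then, for any $\varepsilon>0$, $f$ has an $\varepsilon$-error probabilistic polynomial of degree at most $O(\frac{D}{\delta^2}\log(1/\varepsilon))$ and $L_\infty$ norm at most $L^{O(\frac{1}{\delta^2}\log\frac{1}{\varepsilon})}$, where the constants implicit in the $O(\cdot)$ are absolute.
   Context: An $\varepsilon$-error probabilistic polynomial (over the reals) for a function $f:\{0,1\}^n\to\{0,1\}$ is a random polynomial $\mathbf{P}\in\mathbb{R}[x_1,\ldots,x_n]$ such that for every $a\in\{0,1\}^n$, $\Pr_{\mathbf{P}}[\mathbf{P}(a)\neq f(a)]\leq\varepsilon$. It has degree $D$ and $\Vert\mathbf{P}\Vert_\infty\leq L$ if it is supported on polynomials $P$ of degree at most $D$ with $\max_{a\in\{0,1\}^n}|P(a)|\leq L$ (its $L_\infty$ norm). *)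

theory Defs
  imports "HOL-Probability.Probability" "HOL-Library.Poly_Mapping"
begin

(* R[x_0, x_1, ...]: a monomial is an exponent vector nat =>0 nat, a polynomial is its
   finitely supported coefficient function.  R[x_1, ..., x_n] is the subset of polynomials
   all of whose variables have an index in {..<n}. *)
type_synonym rmpoly = "(nat \<Rightarrow>\<^sub>0 nat) \<Rightarrow>\<^sub>0 real"

definition rmpoly_vars :: "rmpoly \<Rightarrow> nat set" where
  "rmpoly_vars P = (\<Union>m \<in> Poly_Mapping.keys P. Poly_Mapping.keys m)"

definition monom_degree :: "(nat \<Rightarrow>\<^sub>0 nat) \<Rightarrow> nat" where
  "monom_degree m = (\<Sum>i \<in> Poly_Mapping.keys m. Poly_Mapping.lookup m i)"

(* total degree; the zero polynomial gets degree 0 *)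
definition rmpoly_degree :: "rmpoly \<Rightarrow> nat" where
  "rmpoly_degree P = Max (insert 0 (monom_degree ` Poly_Mapping.keys P))"

definition monom_eval :: "(nat \<Rightarrow>\<^sub>0 nat) \<Rightarrow> (nat \<Rightarrow> real) \<Rightarrow> real" where
  "monom_eval m a = (\<Prod>i \<in> Poly_Mapping.keys m. a i ^ Poly_Mapping.lookup m i)"

definition rmpoly_eval :: "rmpoly \<Rightarrow> (nat \<Rightarrow> real) \<Rightarrow> real" where
  "rmpoly_eval P a = (\<Sum>m \<in> Poly_Mapping.keys P. Poly_Mapping.lookup P m * monom_eval m a)"

(* {0,1}^n; outside {..<n} the points take the dummy value undefined *)
definition cube :: "nat \<Rightarrow> (nat \<Rightarrow> real) set" where
  "cube n = ({..<n} \<rightarrow>\<^sub>E {0, 1})"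

definition linf_norm :: "nat \<Rightarrow> rmpoly \<Rightarrow> real" where
  "linf_norm n P = Max ((\<lambda>a. \<bar>rmpoly_eval P a\<bar>) ` cube n)"

(* A random polynomial is given by its distribution M, an arbitrary (not necessarily
   discrete) probability measure on polynomials in n variables for which every coefficient
   is a random variable.  Evaluations are then random variables as well, see
   borel_measurable_rmpoly_eval below. *)
definition random_polynomial :: "nat \<Rightarrow> rmpoly measure \<Rightarrow> bool" where
  "random_polynomial n M \<longleftrightarrow>
     prob_space M \<and>
     (\<forall>P \<in> space M. rmpoly_vars P \<subseteq> {..<n}) \<and>
     (\<forall>m. (\<lambda>P. Poly_Mapping.lookup P m) \<in> borel_measurable M)"

definition probabilistic_polynomial ::
  "nat \<Rightarrow> ((nat \<Rightarrow> real) \<Rightarrow> real) \<Rightarrow> real \<Rightarrow> rmpoly measure \<Rightarrow> bool" where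
  "probabilistic_polynomial n f \<epsilon> M \<longleftrightarrow>
     random_polynomial n M \<and>
     (\<forall>a \<in> cube n. measure M {P \<in> space M. rmpoly_eval P a \<noteq> f a} \<le> \<epsilon>)"

definition supported_degree_le :: "rmpoly measure \<Rightarrow> real \<Rightarrow> bool" where
  "supported_degree_le M d \<longleftrightarrow> (AE P in M. real (rmpoly_degree P) \<le> d)"

definition supported_linf_le :: "nat \<Rightarrow> rmpoly measure \<Rightarrow> real \<Rightarrow> bool" where
  "supported_linf_le n M L \<longleftrightarrow> (AE P in M. linf_norm n P \<le> L)"

lemma countable_monomials: "countable (UNIV :: (nat \<Rightarrow>\<^sub>0 nat) set)"
proof -
  let ?g = "\<lambda>m :: nat \<Rightarrow>\<^sub>0 nat. (\<lambda>i. (i, Poly_Mapping.lookup m i)) ` Poly_Mapping.keys m"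
  have "inj ?g"
  proof (rule injI, rule poly_mapping_eqI)
    fix m m' :: "nat \<Rightarrow>\<^sub>0 nat" and i
    assume eq: "?g m = ?g m'"
    have *: "(i, Poly_Mapping.lookup u i) \<in> ?g u \<longleftrightarrow> Poly_Mapping.lookup u i \<noteq> 0" for u :: "nat \<Rightarrow>\<^sub>0 nat"
      by (auto simp: in_keys_iff)
    show "Poly_Mapping.lookup m i = Poly_Mapping.lookup m' i"
    proof (cases "Poly_Mapping.lookup m i = 0 \<and> Poly_Mapping.lookup m' i = 0")
      case False
      then have "(i, Poly_Mapping.lookup m i) \<in> ?g m' \<or> (i, Poly_Mapping.lookup m' i) \<in> ?g m"
        using *[of m] *[of m'] eq by blast
      then show ?thesis by auto
    qed simp
  qed
  moreover have "countable (range ?g)"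
    by (rule countable_subset[OF _ countable_Collect_finite]) auto
  ultimately show ?thesis
    using countable_image_inj_on by blast
qed

lemma borel_measurable_rmpoly_eval:
  assumes "random_polynomial n M"
  shows "(\<lambda>P. rmpoly_eval P a) \<in> borel_measurable M"
proof (rule borel_measurable_LIMSEQ_real)
  let ?e = "from_nat_into (UNIV :: (nat \<Rightarrow>\<^sub>0 nat) set)"
  let ?S = "\<lambda>k P. \<Sum>m \<in> ?e ` {..<k}. Poly_Mapping.lookup P m * monom_eval m a"
  show "?S k \<in> borel_measurable M" for k
    using assms unfolding random_polynomial_def
    by (intro borel_measurable_sum borel_measurable_times) auto
  show "(\<lambda>k. ?S k P) \<longlonglongrightarrow> rmpoly_eval P a" for P
  proof (rule tendsto_eventually)
    have surj: "surj ?e"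
      using range_from_nat_into[of "UNIV :: (nat \<Rightarrow>\<^sub>0 nat) set"] countable_monomials by simp
    then obtain N where N: "finite N" "Poly_Mapping.keys P = ?e ` N"
      by (metis finite_keys finite_subset_image subset_UNIV)
    then obtain K where K: "N \<subseteq> {..<K}"
      using finite_nat_iff_bounded by blast
    show "\<forall>\<^sub>F k in sequentially. ?S k P = rmpoly_eval P a"
    proof (rule eventually_sequentiallyI)
      fix k assume "K \<le> k"
      with K N have "Poly_Mapping.keys P \<subseteq> ?e ` {..<k}" by fastforce
      then show "?S k P = rmpoly_eval P a"
        unfolding rmpoly_eval_def
        by (intro sum.mono_neutral_right) (auto simp: in_keys_iff)
    qed
  qed
qed

end

theory Submission
  imports Defs
begin

text \<open>
  Let \<open>Q\<close> be the multilinear extension of the majority function applied to \<open>t\<close> independent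
  copies of the given random polynomial. A wrong copy may take any real value, not just the
  wrong bit. This does no harm: once more than half of the arguments are fixed to the same
  bit \<open>b\<close>, the multilinear extension is the constant \<open>b\<close> in the remaining arguments. So \<open>Q\<close> errs
  only if at least half of the copies do, which by Hoeffding has probability at most
  \<open>exp (-2 \<delta>\<^sup>2 t)\<close>; its degree is at most \<open>t D\<close>, and on the cube it is bounded by \<open>(1 + 2 L)\<^sup>t\<close>.
  For \<open>\<epsilon> \<ge> 1/2\<close> the allowed degree can be below one; there a fair coin flip between the constants
  \<open>0\<close> and \<open>1\<close> suffices.
\<close>

section \<open>Multilinear majority\<close>

text \<open>Each summand is the multilinear indicator of the 0/1 vector with support
  \<open>T\<close>. Only strict majorities are summed, so a tie yields 0. The ring is arbitrary
  because the arguments are polynomials in one use and real values in another.\<close>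

definition multilinear_majority :: "'i set \<Rightarrow> ('i \<Rightarrow> 'a::comm_ring_1) \<Rightarrow> 'a" where
  "multilinear_majority I y =
     (\<Sum>T \<in> {T. T \<subseteq> I \<and> card I < 2 * card T}. (\<Prod>i\<in>T. y i) * (\<Prod>i\<in>I - T. 1 - y i))"

text \<open>By counting, a strict majority \<open>T\<close> must meet \<open>S\<close>, and a common
  index puts a zero factor into the first product. Exactly half of the arguments suffice here, since
  ties count as 0.\<close>

lemma multilinear_majority_eq_0:
  fixes y :: "'i \<Rightarrow> 'a::comm_ring_1"
  assumes "finite I" "S \<subseteq> I" "card I \<le> 2 * card S" "\<And>i. i \<in> S \<Longrightarrow> y i = 0"
  shows "multilinear_majority I y = 0"
  unfolding multilinear_majority_def
proof (intro sum.neutral ballI)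
  fix T assume T: "T \<in> {T. T \<subseteq> I \<and> card I < 2 * card T}"
  then have fin: "finite T" "finite S"
    using assms finite_subset by auto
  have "T \<inter> S \<noteq> {}"
  proof
    assume "T \<inter> S = {}"
    then have "card T + card S = card (T \<union> S)"
      using fin by (simp add: card_Un_disjoint)
    also have "\<dots> \<le> card I"
      using T assms by (intro card_mono) auto
    finally show False
      using T assms by simp
  qed
  then obtain i where "i \<in> T" "y i = 0"
    using assms by auto
  then have "(\<Prod>i\<in>T. y i) = 0"
    using fin by (intro prod_zero) auto
  then show "(\<Prod>i\<in>T. y i) * (\<Prod>i\<in>I - T. 1 - y i) = 0"
    by simp
qed

text \<open>A set \<open>T\<close> that is not a strict majority misses some index of
  \<open>S\<close>, where the factor \<open>1 - y i\<close> vanishes. Hence the sum extends to all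
  subsets of \<open>I\<close>, and there it is the expansion of a product of factors
  \<open>y i + (1 - y i) = 1\<close>.\<close>

lemma multilinear_majority_eq_1:
  fixes y :: "'i \<Rightarrow> 'a::comm_ring_1"
  assumes "finite I" "S \<subseteq> I" "card I < 2 * card S" "\<And>i. i \<in> S \<Longrightarrow> y i = 1"
  shows "multilinear_majority I y = 1"
proof -
  have "multilinear_majority I y = (\<Sum>T\<in>Pow I. (\<Prod>i\<in>T. y i) * (\<Prod>i\<in>I - T. 1 - y i))"
    unfolding multilinear_majority_def
  proof (intro sum.mono_neutral_left ballI)
    fix T assume T: "T \<in> Pow I - {T. T \<subseteq> I \<and> card I < 2 * card T}"
    then have "finite T"
      using assms finite_subset by auto
    then have "\<not> S \<subseteq> T"
      using T assms card_mono[of T S] by auto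
    then obtain i where "i \<in> I - T" "1 - y i = 0"
      using assms by auto
    then have "(\<Prod>i\<in>I - T. 1 - y i) = 0"
      using assms by (intro prod_zero) auto
    then show "(\<Prod>i\<in>T. y i) * (\<Prod>i\<in>I - T. 1 - y i) = 0"
      by simp
  qed (use assms in auto)
  also have "\<dots> = (\<Prod>i\<in>I. y i + (1 - y i))"
    using assms by (intro prod_add[symmetric])
  finally show ?thesis
    by simp
qed

text \<open>The deviating arguments may be arbitrary ring elements. This is what makes wrong copies
  with non-Boolean values harmless.\<close>

lemma multilinear_majority_eq:
  fixes y :: "'i \<Rightarrow> 'a::comm_ring_1"
  assumes "finite I" "b \<in> {0, 1}" "2 * card {i \<in> I. y i \<noteq> b} < card I"
  shows "multilinear_majority I y = b"
proof -
  have "card {i \<in> I. y i = b} + card {i \<in> I. y i \<noteq> b} = card I"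
    using assms card_Un_disjoint[of "{i \<in> I. y i = b}" "{i \<in> I. y i \<noteq> b}"]
    by (simp add: disjoint_iff Un_def conj_disj_distribL[symmetric])
  then have more: "card I < 2 * card {i \<in> I. y i = b}"
    using assms by simp
  from assms(2) consider "b = 0" | "b = 1"
    by blast
  then show ?thesis
  proof cases
    case 1
    have "multilinear_majority I y = 0"
      using more 1 by (intro multilinear_majority_eq_0[OF assms(1), of "{i \<in> I. y i = b}"]) auto
    then show ?thesis
      by (simp only: 1)
  next
    case 2
    have "multilinear_majority I y = 1"
      using more 2 by (intro multilinear_majority_eq_1[OF assms(1), of "{i \<in> I. y i = b}"]) auto
    then show ?thesis
      by (simp only: 2)
  qed
qed

text \<open>After the triangle inequality, the missing subsets contribute only nonnegative terms.
  The sum over all subsets factors, with each factor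
  \<open>\<bar>y i\<bar> + \<bar>1 - y i\<bar>\<close> at most \<open>1 + 2 * L\<close>.\<close>

lemma abs_multilinear_majority_le:
  fixes y :: "'i \<Rightarrow> real"
  assumes "finite I" "\<And>i. i \<in> I \<Longrightarrow> \<bar>y i\<bar> \<le> L"
  shows "\<bar>multilinear_majority I y\<bar> \<le> (1 + 2 * L) ^ card I"
proof -
  have "\<bar>multilinear_majority I y\<bar>
      \<le> (\<Sum>T \<in> {T. T \<subseteq> I \<and> card I < 2 * card T}. (\<Prod>i\<in>T. \<bar>y i\<bar>) * (\<Prod>i\<in>I - T. \<bar>1 - y i\<bar>))"
    unfolding multilinear_majority_def
    by (rule order.trans[OF sum_abs]) (simp add: abs_mult abs_prod)
  also have "\<dots> \<le> (\<Sum>T\<in>Pow I. (\<Prod>i\<in>T. \<bar>y i\<bar>) * (\<Prod>i\<in>I - T. \<bar>1 - y i\<bar>))"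
    using assms by (intro sum_mono2) (auto intro!: mult_nonneg_nonneg prod_nonneg)
  also have "\<dots> = (\<Prod>i\<in>I. \<bar>y i\<bar> + \<bar>1 - y i\<bar>)"
    using assms by (intro prod_add[symmetric])
  also have "\<dots> \<le> (\<Prod>i\<in>I. 1 + 2 * L)"
  proof (intro prod_mono conjI)
    fix i assume "i \<in> I"
    then have "\<bar>y i\<bar> \<le> L"
      by (rule assms)
    then show "\<bar>y i\<bar> + \<bar>1 - y i\<bar> \<le> 1 + 2 * L"
      by linarith
  qed auto
  finally show ?thesis
    by simp
qed

section \<open>Evaluation and degree of polynomials\<close>

lemma poly_mapping_sum_single:
  "P = (\<Sum>m\<in>Poly_Mapping.keys P. Poly_Mapping.single m (Poly_Mapping.lookup P m))"
  by (rule poly_mapping_eqI)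
    (auto simp: lookup_sum lookup_single when_def in_keys_iff)

text \<open>Allows two monomials and their sum to be expanded over one common index set; the extra
  exponents are 0.\<close>

lemma monom_eval_superset:
  assumes "finite A" "Poly_Mapping.keys m \<subseteq> A"
  shows "monom_eval m a = (\<Prod>i\<in>A. a i ^ Poly_Mapping.lookup m i)"
  unfolding monom_eval_def using assms
  by (intro prod.mono_neutral_left) (auto simp: in_keys_iff)

lemma monom_eval_0 [simp]: "monom_eval 0 a = 1"
  by (simp add: monom_eval_def)

lemma monom_eval_add: "monom_eval (m + m') a = monom_eval m a * monom_eval m' a"
proof -
  let ?A = "Poly_Mapping.keys m \<union> Poly_Mapping.keys m'"
  have "monom_eval (m + m') a = (\<Prod>i\<in>?A. a i ^ Poly_Mapping.lookup (m + m') i)"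
    using keys_add[of m m'] by (intro monom_eval_superset) auto
  then show ?thesis
    by (simp add: monom_eval_superset[of ?A m] monom_eval_superset[of ?A m']
        lookup_add power_add prod.distrib)
qed

lemma monom_degree_superset:
  assumes "finite A" "Poly_Mapping.keys m \<subseteq> A"
  shows "monom_degree m = (\<Sum>i\<in>A. Poly_Mapping.lookup m i)"
  unfolding monom_degree_def using assms
  by (intro sum.mono_neutral_left) (auto simp: in_keys_iff)

lemma monom_degree_0 [simp]: "monom_degree 0 = 0"
  by (simp add: monom_degree_def)

lemma monom_degree_add: "monom_degree (m + m') = monom_degree m + monom_degree m'"
proof -
  let ?A = "Poly_Mapping.keys m \<union> Poly_Mapping.keys m'"
  have "monom_degree (m + m') = (\<Sum>i\<in>?A. Poly_Mapping.lookup (m + m') i)"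
    using keys_add[of m m'] by (intro monom_degree_superset) auto
  then show ?thesis
    by (simp add: monom_degree_superset[of ?A m] monom_degree_superset[of ?A m']
        lookup_add sum.distrib)
qed

lemma rmpoly_eval_superset:
  assumes "finite A" "Poly_Mapping.keys P \<subseteq> A"
  shows "rmpoly_eval P a = (\<Sum>m\<in>A. Poly_Mapping.lookup P m * monom_eval m a)"
  unfolding rmpoly_eval_def using assms
  by (intro sum.mono_neutral_left) (auto simp: in_keys_iff)

lemma rmpoly_eval_0 [simp]: "rmpoly_eval 0 a = 0"
  by (simp add: rmpoly_eval_def)

lemma rmpoly_eval_1 [simp]: "rmpoly_eval 1 a = 1"
  by (simp add: rmpoly_eval_def)

lemma rmpoly_eval_single: "rmpoly_eval (Poly_Mapping.single m c) a = c * monom_eval m a"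
  by (simp add: rmpoly_eval_def)

lemma rmpoly_eval_add: "rmpoly_eval (P + Q) a = rmpoly_eval P a + rmpoly_eval Q a"
proof -
  let ?A = "Poly_Mapping.keys P \<union> Poly_Mapping.keys Q"
  have "rmpoly_eval (P + Q) a = (\<Sum>m\<in>?A. Poly_Mapping.lookup (P + Q) m * monom_eval m a)"
    using keys_add[of P Q] by (intro rmpoly_eval_superset) auto
  then show ?thesis
    by (simp add: rmpoly_eval_superset[of ?A P] rmpoly_eval_superset[of ?A Q]
        lookup_add distrib_right sum.distrib)
qed

lemma rmpoly_eval_diff: "rmpoly_eval (P - Q) a = rmpoly_eval P a - rmpoly_eval Q a"
  using rmpoly_eval_add[of "P - Q" Q a] by simp

lemma rmpoly_eval_sum: "rmpoly_eval (\<Sum>i\<in>I. p i) a = (\<Sum>i\<in>I. rmpoly_eval (p i) a)"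
  by (induction I rule: infinite_finite_induct) (auto simp: rmpoly_eval_add)

text \<open>Distributivity reduces a product to products of single monomials, so the underlying
  convolution never has to be unfolded.\<close>

lemma rmpoly_mult_eq:
  fixes P Q :: rmpoly
  shows "P * Q = (\<Sum>m\<in>Poly_Mapping.keys P. \<Sum>m'\<in>Poly_Mapping.keys Q.
     Poly_Mapping.single (m + m') (Poly_Mapping.lookup P m * Poly_Mapping.lookup Q m'))"
  by (subst (1) poly_mapping_sum_single[of P], subst (1) poly_mapping_sum_single[of Q])
    (simp add: sum_product mult_single)

lemma rmpoly_eval_mult: "rmpoly_eval (P * Q) a = rmpoly_eval P a * rmpoly_eval Q a"
  unfolding rmpoly_mult_eq rmpoly_eval_sum rmpoly_eval_single monom_eval_add
  by (simp add: rmpoly_eval_def sum_product mult_ac)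

lemma rmpoly_eval_prod: "rmpoly_eval (\<Prod>i\<in>I. p i) a = (\<Prod>i\<in>I. rmpoly_eval (p i) a)"
  by (induction I rule: infinite_finite_induct) (auto simp: rmpoly_eval_mult)

text \<open>Evaluation at a point is a ring homomorphism. This transfers the facts about the
  majority of values to the majority polynomial.\<close>

lemma rmpoly_eval_multilinear_majority:
  "rmpoly_eval (multilinear_majority I p) a = multilinear_majority I (\<lambda>i. rmpoly_eval (p i) a)"
  by (simp add: multilinear_majority_def rmpoly_eval_sum rmpoly_eval_mult rmpoly_eval_prod
      rmpoly_eval_diff)

section \<open>Closure properties of polynomials with bounded variables and degree\<close>

definition rmpolys :: "nat \<Rightarrow> nat \<Rightarrow> rmpoly set" where
  "rmpolys n d = {P. rmpoly_vars P \<subseteq> {..<n} \<and> rmpoly_degree P \<le> d}"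

text \<open>The \<open>0\<close> inserted under the maximum imposes nothing, as \<open>d\<close> is
  a natural number. Both constraints thus become conditions on single monomials, the form in which
  closure is checked.\<close>

lemma rmpolys_iff:
  "P \<in> rmpolys n d \<longleftrightarrow>
     (\<forall>m \<in> Poly_Mapping.keys P. monom_degree m \<le> d \<and> Poly_Mapping.keys m \<subseteq> {..<n})"
  by (auto simp: rmpolys_def rmpoly_vars_def rmpoly_degree_def)

lemma zero_in_rmpolys: "0 \<in> rmpolys n d"
  by (simp add: rmpolys_iff)

lemma one_in_rmpolys: "1 \<in> rmpolys n d"
  by (simp add: rmpolys_iff)

lemma add_in_rmpolys: "P \<in> rmpolys n d \<Longrightarrow> Q \<in> rmpolys n d \<Longrightarrow> P + Q \<in> rmpolys n d"
  using keys_add[of P Q] unfolding rmpolys_iff by blast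

lemma uminus_in_rmpolys: "P \<in> rmpolys n d \<Longrightarrow> - P \<in> rmpolys n d"
  unfolding rmpolys_iff by (simp add: in_keys_iff)

lemma diff_in_rmpolys: "P \<in> rmpolys n d \<Longrightarrow> Q \<in> rmpolys n d \<Longrightarrow> P - Q \<in> rmpolys n d"
  using add_in_rmpolys[OF _ uminus_in_rmpolys, of P n d Q] by simp

lemma sum_in_rmpolys: "(\<And>i. i \<in> I \<Longrightarrow> p i \<in> rmpolys n d) \<Longrightarrow> (\<Sum>i\<in>I. p i) \<in> rmpolys n d"
  by (induction I rule: infinite_finite_induct) (auto intro: add_in_rmpolys zero_in_rmpolys)

lemma mult_in_rmpolys:
  assumes "P \<in> rmpolys n d" "Q \<in> rmpolys n e"
  shows "P * Q \<in> rmpolys n (d + e)"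
  unfolding rmpolys_iff
proof
  fix k assume "k \<in> Poly_Mapping.keys (P * Q)"
  then obtain m m' where k: "k = m + m'"
    and m: "m \<in> Poly_Mapping.keys P" "m' \<in> Poly_Mapping.keys Q"
    using keys_mult[of P Q] by blast
  then show "monom_degree k \<le> d + e \<and> Poly_Mapping.keys k \<subseteq> {..<n}"
    using assms keys_add[of m m'] unfolding rmpolys_iff k monom_degree_add
    by (meson add_mono le_sup_iff order.trans)
qed

lemma prod_in_rmpolys:
  "(\<And>i. i \<in> I \<Longrightarrow> p i \<in> rmpolys n d) \<Longrightarrow> (\<Prod>i\<in>I. p i) \<in> rmpolys n (card I * d)"
  by (induction I rule: infinite_finite_induct) (auto intro: mult_in_rmpolys one_in_rmpolys)

text \<open>Every summand has exactly \<open>card I\<close> factors, each \<open>p i\<close> or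
  \<open>1 - p i\<close>, all of degree at most \<open>d\<close>.\<close>

lemma multilinear_majority_in_rmpolys:
  assumes "finite I" "\<And>i. i \<in> I \<Longrightarrow> p i \<in> rmpolys n d"
  shows "multilinear_majority I p \<in> rmpolys n (card I * d)"
  unfolding multilinear_majority_def
proof (intro sum_in_rmpolys)
  fix T assume T: "T \<in> {T. T \<subseteq> I \<and> card I < 2 * card T}"
  have "(\<Prod>i\<in>T. p i) * (\<Prod>i\<in>I - T. 1 - p i) \<in> rmpolys n (card T * d + card (I - T) * d)"
    using T assms
    by (intro mult_in_rmpolys prod_in_rmpolys diff_in_rmpolys one_in_rmpolys) auto
  moreover have "card T + card (I - T) = card I"
    using T assms card_mono[of I T] finite_subset[of T I] by (simp add: card_Diff_subset)
  ultimately show "(\<Prod>i\<in>T. p i) * (\<Prod>i\<in>I - T. 1 - p i) \<in> rmpolys n (card I * d)"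
    by (metis add_mult_distrib)
qed

section \<open>The maximum norm on the cube\<close>

lemma finite_cube: "finite (cube n)"
  unfolding cube_def by (intro finite_PiE) auto

lemma cube_nonempty: "cube n \<noteq> {}"
  unfolding cube_def by (simp add: PiE_eq_empty_iff)

lemma linf_norm_le_iff: "linf_norm n P \<le> B \<longleftrightarrow> (\<forall>a\<in>cube n. \<bar>rmpoly_eval P a\<bar> \<le> B)"
  unfolding linf_norm_def using finite_cube cube_nonempty by (subst Max_le_iff) auto

section \<open>Measurability of coefficients\<close>

text \<open>Both parts of a decomposition are bounded pointwise by \<open>k\<close>, which leaves
  finitely many exponent vectors for each.\<close>

lemma finite_poly_mapping_decompositions:
  fixes k :: "'a \<Rightarrow>\<^sub>0 nat"
  shows "finite {(l, q). l + q = k}"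
proof -
  let ?D = "{l. \<forall>i. Poly_Mapping.lookup l i \<le> Poly_Mapping.lookup k i}"
  \<comment> \<open>The total degree of \<open>k\<close> serves as one bound for all positions,
    since \<open>finite_set_of_finite_funs\<close> expects a single finite range.\<close>
  have "Poly_Mapping.lookup ` ?D \<subseteq> {f. \<forall>x. (x \<in> Poly_Mapping.keys k \<longrightarrow>
      f x \<in> {..\<Sum>i\<in>Poly_Mapping.keys k. Poly_Mapping.lookup k i}) \<and>
      (x \<notin> Poly_Mapping.keys k \<longrightarrow> f x = 0)}"
  proof safe
    fix l x assume l: "\<forall>i. Poly_Mapping.lookup l i \<le> Poly_Mapping.lookup k i"
    show "Poly_Mapping.lookup l x \<le> (\<Sum>i\<in>Poly_Mapping.keys k. Poly_Mapping.lookup k i)"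
      if "x \<in> Poly_Mapping.keys k"
      using l member_le_sum[of x "Poly_Mapping.keys k" "Poly_Mapping.lookup k"] that
      by (meson finite_keys le0 order.trans)
    show "Poly_Mapping.lookup l x = 0" if "x \<notin> Poly_Mapping.keys k"
      using l that by (metis in_keys_iff le_zero_eq)
  qed
  then have "finite (Poly_Mapping.lookup ` ?D)"
    by (rule finite_subset) (intro finite_set_of_finite_funs, auto)
  then have "finite ?D"
    by (rule finite_imageD) (auto intro!: inj_onI poly_mapping_eqI)
  then have "finite (?D \<times> ?D)"
    by simp
  then show ?thesis
    by (rule finite_subset[rotated]) (auto simp: lookup_add)
qed

text \<open>The index set depends on \<open>k\<close> alone, not on the supports of \<open>P\<close>
  and \<open>Q\<close>. For random factors the coefficient is therefore a fixed finite sum of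
  products of random variables, hence measurable.\<close>

lemma lookup_rmpoly_mult:
  fixes P Q :: rmpoly
  shows "Poly_Mapping.lookup (P * Q) k =
    (\<Sum>(l, q)\<in>{(l, q). l + q = k}. Poly_Mapping.lookup P l * Poly_Mapping.lookup Q q)"
proof -
  let ?K = "Poly_Mapping.keys P \<times> Poly_Mapping.keys Q" and ?E = "{(l, q). l + q = k}"
  let ?g = "\<lambda>(l, q). Poly_Mapping.lookup P l * Poly_Mapping.lookup Q q"
  have "Poly_Mapping.lookup (P * Q) k = (\<Sum>x\<in>?K. if x \<in> ?E then ?g x else 0)"
    unfolding rmpoly_mult_eq lookup_sum lookup_single sum.cartesian_product
    by (intro sum.cong) (auto simp: lookup_single when_def)
  also have "\<dots> = (\<Sum>x\<in>?K \<inter> ?E. ?g x)"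
    by (simp add: sum.inter_restrict)
  also have "\<dots> = (\<Sum>x\<in>?E. ?g x)"
    using finite_poly_mapping_decompositions[of k]
    by (intro sum.mono_neutral_left) (auto simp: in_keys_iff)
  finally show ?thesis .
qed

lemma measurable_coeff_mult:
  fixes P Q :: "'a \<Rightarrow> rmpoly"
  assumes "\<And>m. (\<lambda>\<omega>. Poly_Mapping.lookup (P \<omega>) m) \<in> borel_measurable M"
    and "\<And>m. (\<lambda>\<omega>. Poly_Mapping.lookup (Q \<omega>) m) \<in> borel_measurable M"
  shows "(\<lambda>\<omega>. Poly_Mapping.lookup (P \<omega> * Q \<omega>) k) \<in> borel_measurable M"
  unfolding lookup_rmpoly_mult case_prod_beta
  using assms by (intro borel_measurable_sum borel_measurable_times) auto

lemma measurable_coeff_prod: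
  fixes p :: "'i \<Rightarrow> 'a \<Rightarrow> rmpoly"
  assumes "\<And>i m. i \<in> I \<Longrightarrow> (\<lambda>\<omega>. Poly_Mapping.lookup (p i \<omega>) m) \<in> borel_measurable M"
  shows "(\<lambda>\<omega>. Poly_Mapping.lookup (\<Prod>i\<in>I. p i \<omega>) k) \<in> borel_measurable M"
  using assms
  by (induction I arbitrary: k rule: infinite_finite_induct)
    (auto intro: measurable_coeff_mult)

lemma measurable_coeff_multilinear_majority:
  fixes p :: "'i \<Rightarrow> 'a \<Rightarrow> rmpoly"
  assumes "finite I"
    and "\<And>i m. i \<in> I \<Longrightarrow> (\<lambda>\<omega>. Poly_Mapping.lookup (p i \<omega>) m) \<in> borel_measurable M"
  shows "(\<lambda>\<omega>. Poly_Mapping.lookup (multilinear_majority I (\<lambda>i. p i \<omega>)) k) \<in> borel_measurable M"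
  unfolding multilinear_majority_def lookup_sum
  using assms
  by (intro borel_measurable_sum measurable_coeff_mult measurable_coeff_prod)
    (auto simp: lookup_minus)

section \<open>Random polynomials\<close>

text \<open>
  The \<open>\<sigma>\<close>-algebra on the image is the final one, so that no measurability beyond that of the
  coefficients has to be checked.
\<close>
lemma random_polynomial_image:
  assumes "prob_space \<Omega>"
    and vars: "\<And>\<omega>. \<omega> \<in> space \<Omega> \<Longrightarrow> rmpoly_vars (T \<omega>) \<subseteq> {..<n}"
    and coeff: "\<And>m. (\<lambda>\<omega>. Poly_Mapping.lookup (T \<omega>) m) \<in> borel_measurable \<Omega>"
  obtains Q where "random_polynomial n Q" "space Q = T ` space \<Omega>"
    "\<And>R. {P \<in> space Q. R P} \<in> sets Q \<Longrightarrow>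
       measure Q {P \<in> space Q. R P} = measure \<Omega> {\<omega> \<in> space \<Omega>. R (T \<omega>)}"
proof
  interpret prob_space \<Omega> by fact
  define N where "N = sigma (T ` space \<Omega>) {A. A \<subseteq> T ` space \<Omega> \<and> T -` A \<inter> space \<Omega> \<in> sets \<Omega>}"
  define Q where "Q = distr \<Omega> N T"
  have space_N: "space N = T ` space \<Omega>"
    unfolding N_def by (intro space_measure_of) auto
  have sets_N: "A \<in> sets N" if "A \<subseteq> T ` space \<Omega>" "T -` A \<inter> space \<Omega> \<in> sets \<Omega>" for A
    unfolding N_def using that by (subst sets_measure_of) (auto intro: sigma_sets.Basic)
  have T: "T \<in> measurable \<Omega> N"
    unfolding N_def by (intro measurable_measure_of) auto
  show "space Q = T ` space \<Omega>"
    by (simp add: Q_def space_N)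
  show "random_polynomial n Q"
    unfolding random_polynomial_def
  proof (intro conjI allI ballI)
    show "prob_space Q"
      unfolding Q_def using T by (rule prob_space_distr)
    show "rmpoly_vars P \<subseteq> {..<n}" if "P \<in> space Q" for P
      using that vars by (auto simp: Q_def space_N)
    show "(\<lambda>P. Poly_Mapping.lookup P m) \<in> borel_measurable Q" for m
    proof (rule measurableI)
      fix B :: "real set" assume "B \<in> sets borel"
      then have "(\<lambda>\<omega>. Poly_Mapping.lookup (T \<omega>) m) -` B \<inter> space \<Omega> \<in> sets \<Omega>"
        using coeff by (rule measurable_sets[rotated])
      also have "(\<lambda>\<omega>. Poly_Mapping.lookup (T \<omega>) m) -` B \<inter> space \<Omega> =
          T -` ((\<lambda>P. Poly_Mapping.lookup P m) -` B \<inter> T ` space \<Omega>) \<inter> space \<Omega>"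
        by auto
      finally show "(\<lambda>P. Poly_Mapping.lookup P m) -` B \<inter> space Q \<in> sets Q"
        by (auto simp: Q_def space_N intro!: sets_N)
    qed simp
  qed
  fix R assume "{P \<in> space Q. R P} \<in> sets Q"
  then show "measure Q {P \<in> space Q. R P} = measure \<Omega> {\<omega> \<in> space \<Omega>. R (T \<omega>)}"
    unfolding Q_def using T
    by (subst measure_distr) (auto simp: space_N intro!: arg_cong[where f = prob])
qed

lemma sets_rmpoly_eval_neq:
  assumes "random_polynomial n M"
  shows "{P \<in> space M. rmpoly_eval P a \<noteq> c} \<in> sets M"
  using borel_measurable_rmpoly_eval[OF assms, of a] by measurable

text \<open>Packages the construction of a random polynomial as a function \<open>T\<close> on an
  arbitrary probability space. It serves both the majority on a product space and the coin
  flip.\<close>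

lemma probabilistic_polynomial_image:
  assumes "prob_space \<Omega>"
    and T: "\<And>\<omega>. \<omega> \<in> space \<Omega> \<Longrightarrow> T \<omega> \<in> rmpolys n d"
    and coeff: "\<And>m. (\<lambda>\<omega>. Poly_Mapping.lookup (T \<omega>) m) \<in> borel_measurable \<Omega>"
    and error: "\<And>a. a \<in> cube n \<Longrightarrow>
      measure \<Omega> {\<omega> \<in> space \<Omega>. rmpoly_eval (T \<omega>) a \<noteq> f a} \<le> \<epsilon>"
    and norm: "\<And>\<omega> a. \<omega> \<in> space \<Omega> \<Longrightarrow> a \<in> cube n \<Longrightarrow> \<bar>rmpoly_eval (T \<omega>) a\<bar> \<le> B"
    and bounds: "real d \<le> d'" "B \<le> B'"
  shows "\<exists>Q. probabilistic_polynomial n f \<epsilon> Q \<and> supported_degree_le Q d' \<and>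
    supported_linf_le n Q B'"
proof -
  obtain Q where Q: "random_polynomial n Q" "space Q = T ` space \<Omega>"
    and measure_Q: "\<And>R. {P \<in> space Q. R P} \<in> sets Q \<Longrightarrow>
       measure Q {P \<in> space Q. R P} = measure \<Omega> {\<omega> \<in> space \<Omega>. R (T \<omega>)}"
  proof (rule random_polynomial_image[OF assms(1) _ coeff])
    show "rmpoly_vars (T \<omega>) \<subseteq> {..<n}" if "\<omega> \<in> space \<Omega>" for \<omega>
      using T[OF that] by (simp add: rmpolys_def)
  qed blast
  have "probabilistic_polynomial n f \<epsilon> Q"
    unfolding probabilistic_polynomial_def
    using Q(1) sets_rmpoly_eval_neq[OF Q(1)] by (auto simp: measure_Q intro: error)
  moreover have "supported_degree_le Q d'"
    unfolding supported_degree_le_def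
    using T bounds by (intro AE_I2) (fastforce simp: Q rmpolys_def)
  moreover have "supported_linf_le n Q B'"
    unfolding supported_linf_le_def linf_norm_le_iff
    using norm bounds by (intro AE_I2) (fastforce simp: Q)
  ultimately show ?thesis
    by blast
qed

text \<open>The hypotheses on degree and norm hold only almost everywhere, whereas the image
  construction asks for bounds at every point. Restricting to the complement of a null set keeps a
  probability measure and does not increase the error.\<close>

lemma probabilistic_polynomial_sure_bounds:
  assumes pp: "probabilistic_polynomial n f \<epsilon> M"
    and deg: "supported_degree_le M (real D)" and norm: "supported_linf_le n M L"
  obtains M' where "probabilistic_polynomial n f \<epsilon> M'"
    "\<And>P. P \<in> space M' \<Longrightarrow> P \<in> rmpolys n D"
    "\<And>P a. P \<in> space M' \<Longrightarrow> a \<in> cube n \<Longrightarrow> \<bar>rmpoly_eval P a\<bar> \<le> L"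
proof -
  have rp: "random_polynomial n M"
    using pp by (simp add: probabilistic_polynomial_def)
  then interpret prob_space M
    by (simp add: random_polynomial_def)
  have "AE P in M. real (rmpoly_degree P) \<le> real D \<and> linf_norm n P \<le> L"
    using deg norm unfolding supported_degree_le_def supported_linf_le_def by auto
  \<comment> \<open>Discarding a measurable null set that covers the exceptions avoids a proof that
    the exceptions form a measurable set.\<close>
  then obtain Z where Z: "{P \<in> space M. \<not> (real (rmpoly_degree P) \<le> real D \<and> linf_norm n P \<le> L)} \<subseteq> Z"
    "emeasure M Z = 0" "Z \<in> sets M"
    by (rule AE_E)
  define G where "G = space M - Z"
  define M' where "M' = restrict_space M G"
  have G: "G \<in> sets M" "G \<subseteq> space M"
    using Z by (auto simp: G_def)
  have "emeasure M G = 1"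
    unfolding G_def using Z by (simp add: emeasure_Diff emeasure_space_1 emeasure_compl)
  then have ps: "prob_space M'"
    unfolding M'_def by (intro prob_space_restrict_space G)
  have space_M': "space M' = G"
    using G by (auto simp: M'_def space_restrict_space)
  show thesis
  proof
    show "probabilistic_polynomial n f \<epsilon> M'"
      unfolding probabilistic_polynomial_def random_polynomial_def
    proof (intro conjI allI ballI ps)
      show "rmpoly_vars P \<subseteq> {..<n}" if "P \<in> space M'" for P
        using rp that G by (auto simp: random_polynomial_def space_M')
      show "(\<lambda>P. Poly_Mapping.lookup P m) \<in> borel_measurable M'" for m
        using rp unfolding M'_def random_polynomial_def by (intro measurable_restrict_space1) auto
      fix a assume a: "a \<in> cube n"
      have "measure M' {P \<in> space M'. rmpoly_eval P a \<noteq> f a} =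
          measure M {P \<in> G. rmpoly_eval P a \<noteq> f a}"
        unfolding space_M' unfolding M'_def using G by (intro measure_restrict_space) auto
      also have "\<dots> \<le> measure M {P \<in> space M. rmpoly_eval P a \<noteq> f a}"
        using G sets_rmpoly_eval_neq[OF rp] by (intro finite_measure_mono) auto
      also have "\<dots> \<le> \<epsilon>"
        using pp a by (simp add: probabilistic_polynomial_def)
      finally show "measure M' {P \<in> space M'. rmpoly_eval P a \<noteq> f a} \<le> \<epsilon>" .
    qed
    show "P \<in> rmpolys n D" if "P \<in> space M'" for P
      using that Z(1) rp by (auto simp: space_M' G_def rmpolys_def random_polynomial_def)
    show "\<bar>rmpoly_eval P a\<bar> \<le> L" if "P \<in> space M'" "a \<in> cube n" for P a
      using that Z(1) by (auto simp: space_M' G_def linf_norm_le_iff)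
  qed
qed

section \<open>Amplification\<close>

text \<open>Independence means that the joint law is the product of the marginals. The joint map is
  the identity on the product space, and the marginals are the factors \<open>M i\<close>.\<close>

lemma indep_vars_PiM_components:
  assumes "finite I" "I \<noteq> {}" "\<And>i. i \<in> I \<Longrightarrow> prob_space (M i)"
  shows "prob_space.indep_vars (PiM I M) M (\<lambda>i \<omega>. \<omega> i) I"
proof -
  interpret prob_space "PiM I M"
    using assms by (intro prob_space_PiM)
  have "distr (PiM I M) (PiM I M) (\<lambda>\<omega>. \<lambda>i\<in>I. \<omega> i) = distr (PiM I M) (PiM I M) (\<lambda>\<omega>. \<omega>)"
    by (intro distr_cong) (auto simp: space_PiM PiE_iff extensional_def)
  also have "\<dots> = PiM I (\<lambda>i. distr (PiM I M) (M i) (\<lambda>\<omega>. \<omega> i))"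
    using assms by (auto intro!: PiM_cong simp: distr_PiM_component)
  finally show ?thesis
    using assms by (subst indep_vars_iff_distr_eq_PiM') auto
qed

text \<open>The indicators of \<open>\<omega> i \<in> B\<close> are independent with mean at most
  \<open>1/2 - \<delta>\<close>, so a count of at least \<open>t / 2\<close> exceeds its expectation
  by at least \<open>t * \<delta>\<close>. Ties belong to the event because the majority polynomial
  need not be correct on them.\<close>

lemma Hoeffding_half_of_copies:
  fixes \<delta> :: real
  assumes "prob_space M" "B \<in> sets M" "measure M B \<le> 1/2 - \<delta>" "0 \<le> \<delta>" "0 < t"
  shows "measure (\<Pi>\<^sub>M i\<in>{..<t}. M)
      {\<omega> \<in> space (\<Pi>\<^sub>M i\<in>{..<t}. M). t \<le> 2 * card {i \<in> {..<t}. \<omega> i \<in> B}}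
    \<le> exp (- 2 * real t * \<delta>\<^sup>2)"
proof -
  let ?\<Omega> = "\<Pi>\<^sub>M i\<in>{..<t}. M"
  let ?X = "\<lambda>i \<omega>. indicator B (\<omega> i) :: real"
  interpret M: prob_space M by fact
  interpret prob_space ?\<Omega>
    by (intro prob_space_PiM assms)
  have indep: "indep_vars (\<lambda>_. borel) ?X {..<t}"
    using assms
    by (intro indep_vars_compose2[OF indep_vars_PiM_components[of "{..<t}" "\<lambda>_. M"]]) auto
  interpret Hoeffding_ineq ?\<Omega> "{..<t}" ?X "\<lambda>_. 0" "\<lambda>_. 1" "\<Sum>i<t. expectation (?X i)"
  proof unfold_locales
    show "AE \<omega> in ?\<Omega>. ?X i \<omega> \<in> {0..1}" if "i \<in> {..<t}" for i
      by (intro AE_I2) (simp add: indicator_def)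
  qed (use indep in simp_all)
  have "expectation (?X i) \<le> 1/2 - \<delta>" if "i < t" for i
  proof -
    have "expectation (?X i) = (\<integral>P. indicator B P \<partial>distr ?\<Omega> M (\<lambda>\<omega>. \<omega> i))"
      using that assms
      by (intro integral_distr[symmetric] measurable_component_singleton borel_measurable_indicator) auto
    also have "distr ?\<Omega> M (\<lambda>\<omega>. \<omega> i) = M"
      using that assms by (intro distr_PiM_component) auto
    finally show ?thesis
      using assms by simp
  qed
  then have "(\<Sum>i<t. expectation (?X i)) \<le> (\<Sum>i<t. 1/2 - \<delta>)"
    by (intro sum_mono) auto
  then have mean: "(\<Sum>i<t. expectation (?X i)) \<le> real t / 2 - real t * \<delta>"
    by (simp add: algebra_simps)
  have count: "(\<Sum>i<t. ?X i \<omega>) = real (card {i \<in> {..<t}. \<omega> i \<in> B})" for \<omega>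
    by (simp add: indicator_def sum.If_cases Int_def)
  have "prob {\<omega> \<in> space ?\<Omega>. t \<le> 2 * card {i \<in> {..<t}. \<omega> i \<in> B}}
      \<le> prob {\<omega> \<in> space ?\<Omega>. (\<Sum>i<t. expectation (?X i)) + real t * \<delta> \<le> (\<Sum>i<t. ?X i \<omega>)}"
  proof (intro finite_measure_mono subsetI)
    fix \<omega> assume "\<omega> \<in> {\<omega> \<in> space ?\<Omega>. t \<le> 2 * card {i \<in> {..<t}. \<omega> i \<in> B}}"
    then show "\<omega> \<in> {\<omega> \<in> space ?\<Omega>. (\<Sum>i<t. expectation (?X i)) + real t * \<delta> \<le> (\<Sum>i<t. ?X i \<omega>)}"
      unfolding count using mean by auto
  next
    show "{\<omega> \<in> space ?\<Omega>. (\<Sum>i<t. expectation (?X i)) + real t * \<delta> \<le> (\<Sum>i<t. ?X i \<omega>)} \<in> events"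
      using assms by measurable
  qed
  also have "\<dots> \<le> exp (- 2 * (real t * \<delta>)\<^sup>2 / (\<Sum>i<t. (1 - 0)\<^sup>2))"
    using assms by (intro Hoeffding_ineq_ge) auto
  \<comment> \<open>All \<open>t\<close> ranges have length one, so the denominator is
    \<open>t\<close>.\<close>
  also have "- 2 * (real t * \<delta>)\<^sup>2 / (\<Sum>i<t. (1 - 0)\<^sup>2) = - 2 * real t * \<delta>\<^sup>2"
    using assms by (simp add: power2_eq_square)
  finally show ?thesis .
qed

text \<open>The majority polynomial is taken on the \<open>t\<close>-fold product of the given
  distribution. The number \<open>t\<close> stays a parameter, tied to \<open>\<epsilon>\<close>
  only through the assumption \<open>error\<close>.\<close>

lemma majority_amplification:
  fixes \<delta> :: real
  assumes f: "f \<in> cube n \<rightarrow> {0, 1}" and "0 \<le> \<delta>" "0 < t"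
    and pp: "probabilistic_polynomial n f (1/2 - \<delta>) M"
    and deg: "supported_degree_le M (real D)" and norm: "supported_linf_le n M L"
    and error: "exp (- 2 * real t * \<delta>\<^sup>2) \<le> \<epsilon>"
    and bounds: "real (t * D) \<le> d'" "(1 + 2 * L) ^ t \<le> L'"
  shows "\<exists>Q. probabilistic_polynomial n f \<epsilon> Q \<and> supported_degree_le Q d' \<and>
    supported_linf_le n Q L'"
proof -
  obtain M' where pp': "probabilistic_polynomial n f (1/2 - \<delta>) M'"
    and deg': "\<And>P. P \<in> space M' \<Longrightarrow> P \<in> rmpolys n D"
    and norm': "\<And>P a. P \<in> space M' \<Longrightarrow> a \<in> cube n \<Longrightarrow> \<bar>rmpoly_eval P a\<bar> \<le> L"
    using probabilistic_polynomial_sure_bounds[OF pp deg norm] by blast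
  let ?\<Omega> = "\<Pi>\<^sub>M i\<in>{..<t}. M'"
  have rp: "random_polynomial n M'"
    using pp' by (simp add: probabilistic_polynomial_def)
  then have ps: "prob_space M'"
    and coeff: "\<And>m. (\<lambda>P. Poly_Mapping.lookup P m) \<in> borel_measurable M'"
    by (auto simp: random_polynomial_def)
  interpret prob_space ?\<Omega>
    by (intro prob_space_PiM ps)
  have comp: "\<omega> i \<in> space M'" if "\<omega> \<in> space ?\<Omega>" "i < t" for \<omega> i
    using that by (auto simp: space_PiM)
  show ?thesis
  proof (rule probabilistic_polynomial_image
      [where T = "multilinear_majority {..<t}" and \<Omega> = ?\<Omega> and d = "t * D" and B = "(1 + 2 * L) ^ t"])
    show "multilinear_majority {..<t} \<omega> \<in> rmpolys n (t * D)" if "\<omega> \<in> space ?\<Omega>" for \<omega>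
      using multilinear_majority_in_rmpolys[of "{..<t}" \<omega> n D] comp[OF that] deg' by simp
    show "(\<lambda>\<omega>. Poly_Mapping.lookup (multilinear_majority {..<t} \<omega>) m) \<in> borel_measurable ?\<Omega>" for m
    proof (rule measurable_coeff_multilinear_majority)
      show "(\<lambda>\<omega>. Poly_Mapping.lookup (\<omega> i) k) \<in> borel_measurable ?\<Omega>" if "i \<in> {..<t}" for i k
        using measurable_component_singleton[OF that] coeff by (rule measurable_compose)
    qed simp
    show "\<bar>rmpoly_eval (multilinear_majority {..<t} \<omega>) a\<bar> \<le> (1 + 2 * L) ^ t"
      if "\<omega> \<in> space ?\<Omega>" "a \<in> cube n" for \<omega> a
      using abs_multilinear_majority_le[of "{..<t}" "\<lambda>i. rmpoly_eval (\<omega> i) a" L] that comp norm'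
      by (simp add: rmpoly_eval_multilinear_majority)
    fix a assume a: "a \<in> cube n"
    define B where "B = {P \<in> space M'. rmpoly_eval P a \<noteq> f a}"
    have B: "B \<in> sets M'"
      unfolding B_def by (rule sets_rmpoly_eval_neq[OF rp])
    let ?H = "{\<omega> \<in> space ?\<Omega>. t \<le> 2 * card {i \<in> {..<t}. \<omega> i \<in> B}}"
    \<comment> \<open>As a finite sum of indicators the count is visibly measurable.\<close>
    have "card {i \<in> {..<t}. \<omega> i \<in> B} = (\<Sum>i<t. if \<omega> i \<in> B then 1 else 0)" for \<omega> :: "nat \<Rightarrow> rmpoly"
      by (simp add: sum.If_cases Int_def)
    then have H: "?H \<in> events"
      using B by simp
    \<comment> \<open>Inclusion is enough: with fewer than half of the copies wrong,
      \<open>multilinear_majority_eq\<close> forces the value \<open>f a\<close>.\<close>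
    have "{\<omega> \<in> space ?\<Omega>. rmpoly_eval (multilinear_majority {..<t} \<omega>) a \<noteq> f a} \<subseteq> ?H"
    proof safe
      fix \<omega> assume \<omega>: "\<omega> \<in> space ?\<Omega>" "rmpoly_eval (multilinear_majority {..<t} \<omega>) a \<noteq> f a"
      have "{i \<in> {..<t}. \<omega> i \<in> B} = {i \<in> {..<t}. rmpoly_eval (\<omega> i) a \<noteq> f a}"
        using comp[OF \<omega>(1)] by (auto simp: B_def)
      then show "t \<le> 2 * card {i \<in> {..<t}. \<omega> i \<in> B}"
        using multilinear_majority_eq[of "{..<t}" "f a" "\<lambda>i. rmpoly_eval (\<omega> i) a"] \<omega>(2) f a
        by (fastforce simp: rmpoly_eval_multilinear_majority)
    qed
    then have "prob {\<omega> \<in> space ?\<Omega>. rmpoly_eval (multilinear_majority {..<t} \<omega>) a \<noteq> f a} \<le> prob ?H"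
      using H by (rule finite_measure_mono)
    also have "\<dots> \<le> exp (- 2 * real t * \<delta>\<^sup>2)"
      using pp' a \<open>0 \<le> \<delta>\<close> \<open>0 < t\<close>
      by (intro Hoeffding_half_of_copies ps B) (auto simp: B_def probabilistic_polynomial_def)
    finally show "prob {\<omega> \<in> space ?\<Omega>. rmpoly_eval (multilinear_majority {..<t} \<omega>) a \<noteq> f a} \<le> \<epsilon>"
      using error by simp
  qed (use bounds prob_space_axioms in auto)
qed

lemma coin_flip_probabilistic_polynomial:
  assumes f: "f \<in> cube n \<rightarrow> {0, 1}" and "1/2 \<le> \<epsilon>" "0 \<le> d" "1 \<le> B"
  shows "\<exists>Q. probabilistic_polynomial n f \<epsilon> Q \<and> supported_degree_le Q d \<and> supported_linf_le n Q B"
proof -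
  let ?\<Omega> = "measure_pmf (bernoulli_pmf (1/2))"
  have error: "measure ?\<Omega> {b \<in> space ?\<Omega>. rmpoly_eval (of_bool b) a \<noteq> f a} \<le> \<epsilon>"
    if "a \<in> cube n" for a
  proof -
    have "f a = 0 \<or> f a = 1"
      using f that by auto
    \<comment> \<open>The right-hand side is a singleton containing the truth value of
      \<open>f a = 0\<close>, the one coin outcome that errs at \<open>a\<close>.\<close>
    then have "{b. rmpoly_eval (of_bool b) a \<noteq> f a} = {f a = 0}"
      by (auto simp: of_bool_def split: if_splits)
    then show ?thesis
      using assms by (simp add: measure_pmf_single)
  qed
  have deg: "of_bool b \<in> rmpolys n 0" for b
    by (cases b) (simp_all add: zero_in_rmpolys one_in_rmpolys)
  have norm: "\<bar>rmpoly_eval (of_bool b) a\<bar> \<le> 1" for b a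
    by (cases b) simp_all
  have coeff: "(\<lambda>b. Poly_Mapping.lookup (of_bool b :: rmpoly) m) \<in> borel_measurable ?\<Omega>" for m
    by simp
  show ?thesis
    by (rule probabilistic_polynomial_image[OF measure_pmf.prob_space_axioms deg coeff error norm])
      (use assms in simp_all)
qed

text \<open>The truncation by \<open>max 0\<close> gives the bounds a meaning for
  \<open>\<epsilon> > 1\<close>, where the logarithm is negative.\<close>

theorem theorem1p1:
  shows "\<exists>C::real. C > 0 \<and>
    (\<forall>(n::nat) (f :: (nat \<Rightarrow> real) \<Rightarrow> real) (\<delta>::real) (D::nat) (L::real).
       f \<in> cube n \<rightarrow> {0, 1} \<longrightarrow> 0 < \<delta> \<longrightarrow> \<delta> \<le> 1/2 \<longrightarrow> L \<ge> 2 \<longrightarrow>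
       (\<exists>P. probabilistic_polynomial n f (1/2 - \<delta>) P \<and>
            supported_degree_le P (real D) \<and> supported_linf_le n P L) \<longrightarrow>
       (\<forall>\<epsilon>::real. \<epsilon> > 0 \<longrightarrow>
          (\<exists>Q. probabilistic_polynomial n f \<epsilon> Q \<and>
               supported_degree_le Q (C * (real D / \<delta>\<^sup>2 * max 0 (ln (1/\<epsilon>)))) \<and>
               supported_linf_le n Q (L powr (C * (1 / \<delta>\<^sup>2 * max 0 (ln (1/\<epsilon>))))))))"
\<comment> \<open>The constant 3 comes from \<open>1 + 2 * L \<le> L ^ 3\<close> for
  \<open>2 \<le> L\<close>; the degree bound alone would hold with factor 1.\<close>
proof (intro exI[of _ "3::real"] conjI allI impI)
  fix n D :: nat and f :: "(nat \<Rightarrow> real) \<Rightarrow> real" and \<delta> L \<epsilon> :: real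
  assume f: "f \<in> cube n \<rightarrow> {0, 1}" and \<delta>: "0 < \<delta>" "\<delta> \<le> 1/2" and L: "2 \<le> L" and \<epsilon>: "0 < \<epsilon>"
    and "\<exists>P. probabilistic_polynomial n f (1/2 - \<delta>) P \<and>
      supported_degree_le P (real D) \<and> supported_linf_le n P L"
  then obtain P where P: "probabilistic_polynomial n f (1/2 - \<delta>) P"
    "supported_degree_le P (real D)" "supported_linf_le n P L"
    by blast
  define r where "r = 1 / \<delta>\<^sup>2 * max 0 (ln (1/\<epsilon>))"
  have "\<exists>Q. probabilistic_polynomial n f \<epsilon> Q \<and> supported_degree_le Q (3 * (real D * r)) \<and>
      supported_linf_le n Q (L powr (3 * r))"
  proof (cases "1/2 \<le> \<epsilon>")
    case True
    then show ?thesis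
      using f L by (intro coin_flip_probabilistic_polynomial) (auto simp: r_def ge_one_powr_ge_zero)
  next
    case False
    \<comment> \<open>The aim is \<open>2 \<le> r\<close>: the logarithm is at least
      \<open>1/2\<close>, and \<open>2 * \<delta>\<^sup>2\<close> is at most
      \<open>1/2\<close>.\<close>
    have "ln 2 \<le> ln (1/\<epsilon>)"
      using False \<epsilon> by (subst ln_le_cancel_iff) (auto simp: field_simps)
    then have ln: "1/2 \<le> ln (1/\<epsilon>)"
      using ln2_ge_two_thirds by linarith
    then have r: "r * \<delta>\<^sup>2 = ln (1/\<epsilon>)"
      using \<delta> by (simp add: r_def)
    have "\<delta>\<^sup>2 \<le> (1/2)\<^sup>2"
      using \<delta> by (intro power_mono) auto
    then have "2 * \<delta>\<^sup>2 \<le> r * \<delta>\<^sup>2"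
      unfolding r using ln by (simp add: power2_eq_square)
    then have r2: "2 \<le> r"
      using \<delta> by simp
    \<comment> \<open>The factor 2 in the Hoeffding exponent lets \<open>r / 2\<close> copies
      suffice. Since \<open>2 \<le> r\<close>, rounding up stays below \<open>r\<close>, and
      \<open>t\<close> is positive.\<close>
    define t where "t = nat \<lceil>r / 2\<rceil>"
    have t: "r / 2 \<le> real t" "real t \<le> r"
      using r2 unfolding t_def by linarith+
    have "- 2 * real t * \<delta>\<^sup>2 \<le> - (r * \<delta>\<^sup>2)"
      using mult_right_mono[OF t(1), of "\<delta>\<^sup>2"] by simp
    also have "\<dots> = ln \<epsilon>"
      using \<epsilon> by (simp add: r ln_div)
    finally have error: "exp (- 2 * real t * \<delta>\<^sup>2) \<le> \<epsilon>"
      using \<epsilon> by (metis exp_le_cancel_iff exp_ln)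
    have "1 + 2 * L \<le> 4 * L"
      using L by simp
    also have "4 * L \<le> (L * L) * L"
      using L mult_mono[of 2 L 2 L] by (intro mult_right_mono) auto
    finally have "1 + 2 * L \<le> L ^ 3"
      by (simp add: power3_eq_cube)
    then have "(1 + 2 * L) ^ t \<le> (L ^ 3) ^ t"
      using L by (intro power_mono) auto
    also have "\<dots> = L powr (3 * real t)"
      using L powr_realpow[of L "3 * t"] by (simp add: power_mult)
    also have "\<dots> \<le> L powr (3 * r)"
      using L t by (intro powr_mono) auto
    finally have norm: "(1 + 2 * L) ^ t \<le> L powr (3 * r)" .
    have "real (t * D) \<le> r * real D"
      using t by (simp add: mult_right_mono)
    also have "\<dots> \<le> 3 * (real D * r)"
      using r2 by simp
    finally show ?thesis
      using f \<delta> t r2 P error norm by (intro majority_amplification[where t = t]) auto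
  qed
  then show "\<exists>Q. probabilistic_polynomial n f \<epsilon> Q \<and>
      supported_degree_le Q (3 * (real D / \<delta>\<^sup>2 * max 0 (ln (1/\<epsilon>)))) \<and>
      supported_linf_le n Q (L powr (3 * (1 / \<delta>\<^sup>2 * max 0 (ln (1/\<epsilon>)))))"
    by (simp add: r_def)
qed simp

end
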